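(* Let $k$ be an integer. The ordered set $(\mathcal{D}_k,\leq)$ is isomorphic, as an ordered set, to $(\mathsf{P}_k,\trianglelefteq)$.
   Context: $\mathcal{P}_k$ is the set of partitions of the set $\{1,\dots,k\}\cup\{1',\dots,k'\}$ of $2k$ elements, and $\mathrm{id}_k=\{\{i,i'\}: i=1,\dots,k\}\in\mathcal{P}_k$. A partition $p$ is finer than $p'$ ($p'$ is coarser than $p$) if every block of $p$ is contained in a block of $p'$. $\mathrm{nc}(p)$ is the number of blocks of $p$, $p\vee p'$ is the finest partition coarser than both, and $d(p,p')=\frac12(\mathrm{nc}(p)+\mathrm{nc}(p'))-\mathrm{nc}(p\vee p')$, which is a distance. The order $\leq$ on $\mathcal{P}_k$ is the geodesic order: $p'\leq p$ if and only if $d(\mathrm{id}_k,p')+d(p',p)=d(\mathrm{id}_k,p)$. $\mathcal{D}_k\subset\mathcal{P}_k$ is the set of partitions coarser than $\mathrm{id}_k$, endowed with the restriction of $\leq$. $\mathsf{P}_k$ is the set of partitions of $\{1,\dots,k\}$, endowed with the order $p\trianglelefteq p'$ if and only if $p$ is finer than $p'$. *)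

theory Defs
  imports Complex_Main "HOL-Library.Disjoint_Sets"
begin

text \<open>The element \<open>i\<close> is encoded as \<open>Inl i\<close> and the primed element \<open>i'\<close> as \<open>Inr i\<close>.\<close>

definition points :: "nat \<Rightarrow> (nat + nat) set" where
  "points k = {1..k} <+> {1..k}"

definition partitions2 :: "nat \<Rightarrow> (nat + nat) set set set" where
  "partitions2 k = {p. partition_on (points k) p}"

definition id_part :: "nat \<Rightarrow> (nat + nat) set set" where
  "id_part k = (\<lambda>i. {Inl i, Inr i}) ` {1..k}"

text \<open>The library predicate \<open>refines A P Q\<close> says that \<open>P\<close> and \<open>Q\<close> are partitions of \<open>A\<close> and that
  \<open>P\<close> is finer than \<open>Q\<close>.\<close>

definition is_part_join :: "'a set \<Rightarrow> 'a set set \<Rightarrow> 'a set set \<Rightarrow> 'a set set \<Rightarrow> bool" where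
  "is_part_join A P Q R \<longleftrightarrow> refines A P R \<and> refines A Q R \<and>
     (\<forall>S. refines A P S \<and> refines A Q S \<longrightarrow> refines A R S)"

definition part_join :: "'a set \<Rightarrow> 'a set set \<Rightarrow> 'a set set \<Rightarrow> 'a set set" where
  "part_join A P Q = (THE R. is_part_join A P Q R)"

lemma is_part_join_part_join:
  assumes P: "partition_on A P" and Q: "partition_on A Q"
  shows "is_part_join A P Q (part_join A P Q)"
proof -
  define U where "U = {S. refines A P S \<and> refines A Q S}"
  have top: "\<exists>S. S \<in> U"
  proof (cases "A = {}")
    case True
    with P Q have "P = {}" "Q = {}" by (simp_all add: partition_on_empty)
    with True show ?thesis by (auto simp: U_def refines_def partition_on_empty)
  next
    case False
    then have "{A} \<in> U"
      using P Q partition_on_space[OF False] by (auto simp: U_def refines_def partition_on_def)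
    then show ?thesis ..
  qed
  have part: "partition_on A S" if "S \<in> U" for S
    using that by (auto simp: U_def refines_def)
  have "is_part_join A P Q (common_refinement U)"
    unfolding is_part_join_def
  proof (intro conjI allI impI)
    show "refines A P (common_refinement U)"
      by (rule common_refinement_coarsest) (use part P top in \<open>auto simp: U_def\<close>)
    show "refines A Q (common_refinement U)"
      by (rule common_refinement_coarsest) (use part Q top in \<open>auto simp: U_def\<close>)
    show "refines A (common_refinement U) S" if "refines A P S \<and> refines A Q S" for S
      by (rule refines_common_refinement) (use part that in \<open>auto simp: U_def\<close>)
  qed
  moreover have "R = R'" if "is_part_join A P Q R" "is_part_join A P Q R'" for R R'
    using that unfolding is_part_join_def by (meson refines_asym)
  ultimately show ?thesis
    unfolding part_join_def by (metis theI)
qed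

definition part_dist :: "nat \<Rightarrow> (nat + nat) set set \<Rightarrow> (nat + nat) set set \<Rightarrow> real" where
  "part_dist k p p' =
     (real (card p) + real (card p')) / 2 - real (card (part_join (points k) p p'))"

definition geo_le :: "nat \<Rightarrow> (nat + nat) set set \<Rightarrow> (nat + nat) set set \<Rightarrow> bool" where
  "geo_le k p' p \<longleftrightarrow>
     part_dist k (id_part k) p' + part_dist k p' p = part_dist k (id_part k) p"

definition coarse_partitions :: "nat \<Rightarrow> (nat + nat) set set set" where
  "coarse_partitions k = {p \<in> partitions2 k. refines (points k) (id_part k) p}"

definition partitions1 :: "nat \<Rightarrow> nat set set set" where
  "partitions1 k = {p. partition_on {1..k} p}"

end

theory Submission
  imports Defs
begin

text \<open>If \<open>p'\<close> and \<open>p\<close> are both coarser than \<open>id\<^sub>k\<close>, then the joins with \<open>id\<^sub>k\<close> are \<open>p'\<close> and \<open>p\<close>, and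
  the equation defining \<open>p' \<le> p\<close> reduces to \<open>nc(p' \<squnion> p) = nc(p)\<close>. As \<open>p' \<squnion> p\<close> is coarser than \<open>p\<close>,
  this means \<open>p' \<squnion> p = p\<close>, that is, \<open>p'\<close> is finer than \<open>p\<close>. Finally, a partition is coarser than
  \<open>id\<^sub>k\<close> exactly when each of its blocks is of the form \<open>X \<union> X'\<close> with \<open>X \<subseteq> {1,\<dots>,k}\<close>, and
  restriction to the unprimed elements is the isomorphism.\<close>

text \<open>Sending each block of \<open>P\<close> to the block of \<open>Q\<close> that contains it
  is a surjection. Between finite sets of equal size it is injective, so no block of
  \<open>Q\<close> can split into several blocks of \<open>P\<close>.\<close>

lemma refines_card_eq_imp_eq:
  assumes fin: "finite A" and ref: "refines A P Q" and card: "card P = card Q"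
  shows "P = Q"
proof -
  have P: "partition_on A P" and Q: "partition_on A Q"
    and ex: "\<forall>X\<in>P. \<exists>Y\<in>Q. X \<subseteq> Y"
    using ref by (auto simp: refines_def)
  obtain h where h: "\<And>X. X \<in> P \<Longrightarrow> h X \<in> Q" "\<And>X. X \<in> P \<Longrightarrow> X \<subseteq> h X"
    using ex by metis
  have same: "X = Y"
    if "X \<in> R" "Y \<in> R" "a \<in> X" "a \<in> Y" "partition_on A R" for X Y a R
    using that unfolding partition_on_def disjoint_def by blast
  have finP: "finite P"
    using finite_elements fin P by blast
  have surj: "h ` P = Q"
  proof
    show "h ` P \<subseteq> Q" using h by blast
    show "Q \<subseteq> h ` P"
    proof
      fix Y assume Y: "Y \<in> Q"
      then have "Y \<noteq> {}" "Y \<subseteq> A"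
        using Q unfolding partition_on_def by auto
      then obtain a where a: "a \<in> Y" "a \<in> A"
        by blast
      then obtain X where X: "X \<in> P" "a \<in> X"
        using P unfolding partition_on_def by blast
      have "h X = Y"
        using same[of "h X" Q Y a] X h Y a Q by blast
      with X show "Y \<in> h ` P" by blast
    qed
  qed
  have inj: "inj_on h P"
    using finP surj card by (simp add: eq_card_imp_inj_on)
  \<comment> \<open>A point of \<open>h X\<close> outside \<open>X\<close> would lie in another
    block \<open>Z\<close> of \<open>P\<close> with \<open>h Z = h X\<close>, against
    injectivity.\<close>
  have "h X = X" if X: "X \<in> P" for X
  proof
    show "X \<subseteq> h X" using h X by blast
    show "h X \<subseteq> X"
    proof
      fix a assume a: "a \<in> h X"
      then have "a \<in> A"
        using Q h X unfolding partition_on_def by blast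
      then obtain Z where Z: "Z \<in> P" "a \<in> Z"
        using P unfolding partition_on_def by blast
      have "h Z = h X"
        using same[of "h Z" Q "h X" a] Z h X a Q by blast
      with inj X Z show "a \<in> X" by (auto dest: inj_onD)
    qed
  qed
  with surj show ?thesis by force
qed

lemma part_join_eq_iff_refines:
  assumes P: "partition_on A P" and Q: "partition_on A Q"
  shows "part_join A P Q = Q \<longleftrightarrow> refines A P Q"
proof
  show "refines A P Q" if "part_join A P Q = Q"
    using is_part_join_part_join[OF P Q] that unfolding is_part_join_def by simp
  show "part_join A P Q = Q" if "refines A P Q"
    using is_part_join_part_join[OF P Q] that refines_refl[OF Q] refines_asym
    unfolding is_part_join_def by blast
qed

lemma finite_points: "finite (points k)"
  by (simp add: points_def)

lemma geo_le_iff_refines: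
  assumes p': "p' \<in> coarse_partitions k" and p: "p \<in> coarse_partitions k"
  shows "geo_le k p' p \<longleftrightarrow> refines (points k) p' p"
proof -
  let ?A = "points k" and ?j = "part_join (points k) p' p"
  have part: "partition_on ?A p'" "partition_on ?A p"
    using p' p by (auto simp: coarse_partitions_def partitions2_def)
  have id_join: "part_join ?A (id_part k) q = q" if "q \<in> coarse_partitions k" for q
    using that part_join_eq_iff_refines[of ?A "id_part k" q]
    by (auto simp: coarse_partitions_def refines_def)
  \<comment> \<open>For \<open>q\<close> coarser than the identity partition, its distance to the
    latter is half of nc(id) - nc(q). The terms nc(id) and nc(p') therefore cancel in the geodesic
    equation.\<close>
  have "geo_le k p' p \<longleftrightarrow> card p = card ?j"
    unfolding geo_le_def part_dist_def id_join[OF p] id_join[OF p']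
    by (simp add: field_simps)
  also have "\<dots> \<longleftrightarrow> ?j = p"
    using refines_card_eq_imp_eq[OF finite_points, of k p ?j] is_part_join_part_join[OF part]
    by (auto simp: is_part_join_def)
  also have "\<dots> \<longleftrightarrow> refines ?A p' p"
    by (rule part_join_eq_iff_refines[OF part])
  finally show ?thesis .
qed

text \<open>Here \<open>X <+> X\<close> encodes X \<union> X', so this map goes from partitions of
  {1,...,k} to coarse partitions; the isomorphism will be its inverse.\<close>

definition double_part :: "'a set set \<Rightarrow> ('a + 'a) set set" where
  "double_part q = (\<lambda>X. X <+> X) ` q"

lemma Plus_self_subset_iff: "X <+> X \<subseteq> Y <+> Y \<longleftrightarrow> X \<subseteq> Y"
  by auto

lemma inj_Plus_self: "inj (\<lambda>X. X <+> X)"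
  by (rule injI) (metis Plus_self_subset_iff subset_antisym subset_refl)

lemma inj_double_part: "inj double_part"
  unfolding double_part_def by (rule injI) (simp add: inj_image_eq_iff[OF inj_Plus_self])

text \<open>Doubling preserves and reflects unions, disjointness and emptiness, so the clauses of
  \<open>partition_on\<close> transfer one by one. One direction places doubled partitions among the
  coarse ones, the other gives surjectivity.\<close>

lemma partition_on_double_part_iff:
  "partition_on (A <+> A) (double_part q) \<longleftrightarrow> partition_on A q"
proof -
  have "\<Union> (double_part q) = A <+> A \<longleftrightarrow> \<Union> q = A"
  proof -
    have "\<Union> (double_part q) = \<Union> q <+> \<Union> q"
      by (auto simp: double_part_def)
    then show ?thesis
      by (metis Plus_self_subset_iff subset_antisym subset_refl)
  qed
  moreover have "disjoint (double_part q) \<longleftrightarrow> disjoint q"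
  proof -
    have "(X <+> X) \<inter> (Y <+> Y) = {} \<longleftrightarrow> X \<inter> Y = {}" for X Y :: "'a set"
      by auto
    moreover have "X <+> X = Y <+> Y \<longleftrightarrow> X = Y" for X Y :: "'a set"
      using inj_Plus_self by (auto dest: injD)
    ultimately show ?thesis
      by (simp add: double_part_def disjoint_def)
  qed
  moreover have "{} \<in> double_part q \<longleftrightarrow> {} \<in> q"
  proof -
    have "{} = X <+> X \<longleftrightarrow> X = {}" for X :: "'a set"
      by auto
    then show ?thesis
      by (simp add: double_part_def image_iff)
  qed
  ultimately show ?thesis
    by (simp add: partition_on_def)
qed

lemma refines_double_part_iff:
  "refines (A <+> A) (double_part q) (double_part r) \<longleftrightarrow> refines A q r"
  by (simp add: refines_def partition_on_double_part_iff)
     (simp add: double_part_def Plus_self_subset_iff)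

lemma partition_on_id_part: "partition_on (points k) (id_part k)"
  by (auto simp: partition_on_def points_def id_part_def disjoint_def)

lemma double_part_in_coarse_partitions:
  assumes "q \<in> partitions1 k"
  shows "double_part q \<in> coarse_partitions k"
proof -
  have q: "partition_on {1..k} q"
    using assms by (simp add: partitions1_def)
  then have "partition_on (points k) (double_part q)"
    by (simp add: points_def partition_on_double_part_iff)
  moreover have "\<exists>Y\<in>double_part q. X \<subseteq> Y" if X: "X \<in> id_part k" for X
  proof -
    obtain i where i: "i \<in> {1..k}" "X = {Inl i, Inr i}"
      using X by (auto simp: id_part_def)
    then obtain B where "B \<in> q" "i \<in> B"
      using q unfolding partition_on_def by blast
    then have "B <+> B \<in> double_part q" "X \<subseteq> B <+> B"
      using i by (auto simp: double_part_def)
    then show ?thesis by blast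
  qed
  ultimately show ?thesis
    by (simp add: coarse_partitions_def partitions2_def refines_def partition_on_id_part)
qed

text \<open>Coarseness puts \<open>Inl i\<close> and \<open>Inr i\<close> into a common block, and
  by disjointness every block contains both or neither. A block is thus determined by its unprimed
  half.\<close>

lemma coarse_partition_block_eq:
  assumes p: "p \<in> coarse_partitions k" and B: "B \<in> p"
  shows "(Inl -` B) <+> (Inl -` B) = B"
proof -
  have part: "partition_on (points k) p"
    using p by (simp add: coarse_partitions_def partitions2_def)
  have "Inl i \<in> B \<longleftrightarrow> Inr i \<in> B" for i
  proof (cases "i \<in> {1..k}")
    case True
    then have "{Inl i, Inr i} \<in> id_part k"
      by (simp add: id_part_def)
    then obtain C where "C \<in> p" "{Inl i, Inr i} \<subseteq> C"
      using p unfolding coarse_partitions_def refines_def by blast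
    then show ?thesis
      using part B unfolding partition_on_def disjoint_def by blast
  next
    case False
    moreover have "B \<subseteq> points k"
      using part B unfolding partition_on_def by blast
    ultimately show ?thesis
      by (auto simp: points_def)
  qed
  then have "x \<in> (Inl -` B) <+> (Inl -` B) \<longleftrightarrow> x \<in> B" for x
    by (cases x) auto
  then show ?thesis by blast
qed

lemma bij_betw_double_part: "bij_betw double_part (partitions1 k) (coarse_partitions k)"
proof (rule bij_betw_imageI)
  show "inj_on double_part (partitions1 k)"
    using inj_double_part by (rule inj_on_subset) simp
  show "double_part ` partitions1 k = coarse_partitions k"
  proof
    show "double_part ` partitions1 k \<subseteq> coarse_partitions k"
      using double_part_in_coarse_partitions by blast
    show "coarse_partitions k \<subseteq> double_part ` partitions1 k"
    proof
      fix p assume p: "p \<in> coarse_partitions k"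
      let ?q = "(\<lambda>B. Inl -` B) ` p"
      have eq: "double_part ?q = p"
        using coarse_partition_block_eq[OF p] by (simp add: double_part_def image_image)
      \<comment> \<open>That the unprimed halves form a partition is reflected from their double,
        which is \<open>p\<close> itself.\<close>
      moreover have "?q \<in> partitions1 k"
        using p partition_on_double_part_iff[of "{1..k}" ?q] unfolding eq
        by (simp add: coarse_partitions_def partitions2_def partitions1_def points_def)
      ultimately show "p \<in> double_part ` partitions1 k"
        by (metis image_eqI)
    qed
  qed
qed

theorem theorem3p2:
  fixes k :: nat
  shows "\<exists>f. bij_betw f (coarse_partitions k) (partitions1 k) \<and>
    (\<forall>p' \<in> coarse_partitions k. \<forall>p \<in> coarse_partitions k.
       geo_le k p' p \<longleftrightarrow> refines {1..k} (f p') (f p))"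
proof (intro exI conjI ballI)
  \<comment> \<open>On coarse partitions this inverse is restriction to the unprimed elements. Order
    transfers because the geodesic order is refinement there, and doubling preserves and reflects
    refinement.\<close>
  let ?f = "inv_into (partitions1 k) double_part"
  show "bij_betw ?f (coarse_partitions k) (partitions1 k)"
    by (rule bij_betw_inv_into[OF bij_betw_double_part])
  fix p' p assume p': "p' \<in> coarse_partitions k" and p: "p \<in> coarse_partitions k"
  have "double_part (?f p') = p'" "double_part (?f p) = p"
    using p p' bij_betw_inv_into_right[OF bij_betw_double_part] by blast+
  then show "geo_le k p' p \<longleftrightarrow> refines {1..k} (?f p') (?f p)"
    using geo_le_iff_refines[OF p' p] refines_double_part_iff[of "{1..k}" "?f p'" "?f p"]
    by (simp add: points_def)
qed

end
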